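(* Let $b$ be a prime, let $m,s,\alpha,d\in\mathbb{N}$ with $\alpha\ge2$, and let $\boldsymbol{\gamma}=(\gamma_u)_{u\subseteq I_s}$ be a set of non-negative weights, where $I_s=\{1,\ldots,s\}$. Let $p\in\mathbb{F}_b[x]$ and $\boldsymbol{q}=(q_1,\ldots,q_{ds})\in(\mathbb{F}_b[x])^{ds}$ be found by the component-by-component algorithm (described in the context). For $1\le r\le ds$ write $\boldsymbol{q}_r=(q_1,\ldots,q_r)$ and $r=d(j_1-1)+d_1$ with $j_1,d_1\in\mathbb{N}$ and $d_1\in\{1,\ldots,d\}$. Then for any $1\le r\le ds$ and any real $\lambda$ with $1/(2\min(\alpha,d))<\lambda\le1$, $$B_{\alpha,d,\boldsymbol{\gamma}}(\boldsymbol{q}_r,p)\le\frac{1}{(b^m-1)^{1/\lambda}}\Big[\sum_{\emptyset\ne u\subseteq I_{j_1-1}}\gamma_u^{\lambda}G_{\alpha,d,\lambda,d}^{|u|}+G_{\alpha,d,\lambda,d_1}\sum_{u\subseteq I_{j_1-1}}\gamma_{u\cup\{j_1\}}^{\lambda}G_{\alpha,d,\lambda,d}^{|u|}\Big]^{1/\lambda},$$ where for $1\le a\le d$ $$G_{\alpha,d,\lambda,a}=\tilde{D}_{\alpha,b,d}^{\lambda}\big(-1+(1+C_{\alpha,d,\lambda})^a\big),\qquad C_{\alpha,d,\lambda}=\frac{1}{b^{\alpha\lambda}}\max\Big\{\Big(\frac{b-1}{b^{2\min(\alpha,d)}-b}\Big)^{\lambda},\frac{b-1}{b^{2\lambda\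min(\alpha,d)}-b}\Big\}.$$
   Context: Notation: $\mathbb{N}=\{1,2,\ldots\}$, $\mathbb{N}_0=\mathbb{N}\cup\{0\}$, $I_n=\{1,\ldots,n\}$ ($I_0=\emptyset$), $\mathbb{F}_b$ the field of $b$ elements $\{0,\ldots,b-1\}$, $R_{b,m}=\{q\in\mathbb{F}_b[x]:\deg(q)<m,\ q\ne0\}$. Dual net: for $k=\kappa_0+\kappa_1b+\cdots\in\mathbb{N}_0$ (base-$b$ digits) let $\mathrm{tr}_m(k)(x)=\kappa_0+\kappa_1x+\cdots+\kappa_{m-1}x^{m-1}\in\mathbb{F}_b[x]$. For $p$ with $\deg(p)=m$ and $\boldsymbol{q}_r\in(\mathbb{F}_b[x])^r$, $D^{\perp}(\boldsymbol{q}_r,p)=\{\boldsymbol{k}\in\mathbb{N}_0^r:\sum_{j=1}^{r}\mathrm{tr}_m(k_j)q_j\equiv0\pmod p\}$. Criterion: for $1\le r\le ds$, $$B_{\alpha,d,\boldsymbol{\gamma}}(\boldsymbol{q}_r,p)=\sum_{\emptyset\ne w\subseteq I_r}\gamma_{\phi(w)}\tilde{D}_{\alpha,b,d}^{|\phi(w)|}\sum_{\substack{\boldsymbol{l}_w\in\mathbb{N}^{|w|}\\(\boldsymbol{l}_w,\boldsymbol{0})\in D^{\perp}(\boldsymbol{q}_r,p)}}\ \prod_{j\in w}r_{\alpha,d}(l_j),$$ where $(\boldsymbol{l}_w,\boldsymbol{0})$ is the $r$-dimensional vector with $j$-th component $l_j$ if $j\in w$ and $0$ otherwise; $\phi(w)=\{1\le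 j\le s:w\cap\{d(j-1)+1,\ldots,dj\}\ne\emptyset\}$; $r_{\alpha,d}(l)=b^{-2\min(\alpha,d)\mu_1(l)-\alpha}$ for $l\ge1$, with $\mu_1(l)=a$ if $b^{a-1}\le l<b^a$. Constants: $\tilde{D}_{\alpha,b,d}=b^{(2d-1)\alpha}D_{\alpha,b}$, $D_{\alpha,b}=\max_{1\le\nu\le\alpha}\big(C'_{\alpha,b,\nu}+\tilde{C}_{2\alpha,b}b^{-2(\alpha-\nu)}\big)$, $C'_{\alpha,b,\nu}=\sum_{\tau=\nu}^{\alpha}C_{\tau,b}^2b^{-2(\tau-\nu)}$, $C_{1,b}=(2\sin(\pi/b))^{-1}$, $C_{\tau,b}=(1+1/b+1/(b(b+1)))^{\tau-2}/(2\sin(\pi/b))^{\tau}$ for $\tau\ge2$, $\tilde{C}_{2\alpha,b}=2(1+1/b+1/(b(b+1)))^{2\alpha-2}/(2\sin(\pi/b))^{2\alpha}$. Component-by-component algorithm: (1) choose an irreducible polynomial $p\in\mathbb{F}_b[x]$ with $\deg(p)=m$; (2) set $q_1=1$; (3) for $r=2,\ldots,ds$ successively, with $\boldsymbol{q}_{r-1}=(q_1,\ldots,q_{r-1})$ already found, let $q_r\in R_{b,m}$ be a minimizer of $q_r^*\mapsto B_{\alpha,d,\boldsymbol{\gamma}}((\boldsymbol{q}_{r-1},q_r^* ),p)$ over $q_r^*\in R_{b,m}$. *)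

theory Defs
  imports
    "HOL-Analysis.Analysis"
    "HOL-Computational_Algebra.Polynomial"
    "HOL-Computational_Algebra.Primes"
    "HOL-Number_Theory.Cong"
    "HOL-Library.Log_Nat"
begin

text \<open>
  The type \<open>'k\<close> plays the role of the field with \<open>b\<close> elements, \<open>b\<close> prime, and a digit
  \<open>0 \<le> \<kappa> < b\<close> is identified with the field element \<open>of_nat \<kappa>\<close>. Vectors of length \<open>r\<close> are
  functions on \<open>{1..r}\<close>; only the values \<open>q 1, \<dots>, q r\<close> of a function \<open>q :: nat \<Rightarrow> 'k poly\<close> are used
  when it stands for a vector of length \<open>r\<close>.
\<close>

definition nonzero_polys :: "nat \<Rightarrow> 'k::field poly set" where
  "nonzero_polys m = {q. degree q < m \<and> q \<noteq> 0}"

definition tr :: "nat \<Rightarrow> nat \<Rightarrow> nat \<Rightarrow> 'k::field poly" where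
  "tr b m k = (\<Sum>i<m. monom (of_nat ((k div b ^ i) mod b)) i)"

definition dual_net :: "nat \<Rightarrow> nat \<Rightarrow> (nat \<Rightarrow> 'k::field poly) \<Rightarrow> 'k poly \<Rightarrow> (nat \<Rightarrow> nat) set" where
  "dual_net b r q p =
     {k \<in> {1..r} \<rightarrow>\<^sub>E UNIV. [(\<Sum>j\<in>{1..r}. tr b (degree p) (k j) * q j) = 0] (mod p)}"

definition mu1 :: "nat \<Rightarrow> nat \<Rightarrow> nat" where
  "mu1 b l = (THE a. 1 \<le> a \<and> b ^ (a - 1) \<le> l \<and> l < b ^ a)"

definition r_weight :: "nat \<Rightarrow> nat \<Rightarrow> nat \<Rightarrow> nat \<Rightarrow> real" where
  "r_weight b \<alpha> d l = real b powi (- 2 * int (min \<alpha> d) * int (mu1 b l) - int \<alpha>)"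

definition \<phi> :: "nat \<Rightarrow> nat \<Rightarrow> nat set \<Rightarrow> nat set" where
  "\<phi> s d w = {j \<in> {1..s}. w \<inter> {d * (j - 1) + 1..d * j} \<noteq> {}}"

text \<open>\<open>C_const\<close> is only meant for \<open>\<tau> \<ge> 1\<close>.\<close>

definition C_const :: "nat \<Rightarrow> nat \<Rightarrow> real" where
  "C_const \<tau> b =
     (if \<tau> = 1 then inverse (2 * sin (pi / real b))
      else (1 + 1 / real b + 1 / (real b * (real b + 1))) ^ (\<tau> - 2) / (2 * sin (pi / real b)) ^ \<tau>)"

definition C_prime :: "nat \<Rightarrow> nat \<Rightarrow> nat \<Rightarrow> real" where
  "C_prime \<alpha> b \<nu> = (\<Sum>\<tau> = \<nu>..\<alpha>. (C_const \<tau> b)\<^sup>2 / real b ^ (2 * (\<tau> - \<nu>)))"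

text \<open>\<open>C_tilde \<alpha> b\<close> is the constant with index \<open>2\<alpha>\<close>.\<close>

definition C_tilde :: "nat \<Rightarrow> nat \<Rightarrow> real" where
  "C_tilde \<alpha> b =
     2 * (1 + 1 / real b + 1 / (real b * (real b + 1))) ^ (2 * \<alpha> - 2) / (2 * sin (pi / real b)) ^ (2 * \<alpha>)"

definition D_const :: "nat \<Rightarrow> nat \<Rightarrow> real" where
  "D_const \<alpha> b = Max ((\<lambda>\<nu>. C_prime \<alpha> b \<nu> + C_tilde \<alpha> b / real b ^ (2 * (\<alpha> - \<nu>))) ` {1..\<alpha>})"

definition D_tilde :: "nat \<Rightarrow> nat \<Rightarrow> nat \<Rightarrow> real" where
  "D_tilde \<alpha> b d = real b ^ ((2 * d - 1) * \<alpha>) * D_const \<alpha> b"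

text \<open>The vector of length \<open>r\<close> with the entries of \<open>l\<close> on \<open>w\<close> and zeros elsewhere.\<close>

definition zero_pad :: "nat \<Rightarrow> nat set \<Rightarrow> (nat \<Rightarrow> nat) \<Rightarrow> (nat \<Rightarrow> nat)" where
  "zero_pad r w l = (\<lambda>j\<in>{1..r}. if j \<in> w then l j else 0)"

text \<open>
  The inner infinite sums range over non-negative terms and converge, see
  \<open>summable_prod_r_weight\<close> below, so \<open>infsum\<close> never takes its default value.
\<close>

definition B_crit ::
  "nat \<Rightarrow> nat \<Rightarrow> nat \<Rightarrow> nat \<Rightarrow> (nat set \<Rightarrow> real) \<Rightarrow> nat \<Rightarrow> (nat \<Rightarrow> 'k::field poly) \<Rightarrow> 'k poly \<Rightarrow> real" where
  "B_crit b s \<alpha> d \<gamma> r q p =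
     (\<Sum>w\<in>Pow {1..r} - {{}}.
        \<gamma> (\<phi> s d w) * D_tilde \<alpha> b d ^ card (\<phi> s d w) *
        (\<Sum>\<^sub>\<infinity>l\<in>{l \<in> w \<rightarrow>\<^sub>E {1..}. zero_pad r w l \<in> dual_net b r q p}.
           \<Prod>j\<in>w. r_weight b \<alpha> d (l j)))"

definition cbc_output ::
  "nat \<Rightarrow> nat \<Rightarrow> nat \<Rightarrow> nat \<Rightarrow> nat \<Rightarrow> (nat set \<Rightarrow> real) \<Rightarrow> 'k::field poly \<Rightarrow> (nat \<Rightarrow> 'k poly) \<Rightarrow> bool" where
  "cbc_output b m s \<alpha> d \<gamma> p q \<longleftrightarrow>
     irreducible p \<and> degree p = m \<and> q 1 = 1 \<and>
     (\<forall>r\<in>{2..d * s}.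
        is_arg_min (\<lambda>q'. B_crit b s \<alpha> d \<gamma> r (q(r := q')) p) (\<lambda>q'. q' \<in> nonzero_polys m) (q r))"

definition C_lambda :: "nat \<Rightarrow> nat \<Rightarrow> nat \<Rightarrow> real \<Rightarrow> real" where
  "C_lambda b \<alpha> d lam =
     1 / real b powr (real \<alpha> * lam) *
     max (((real b - 1) / (real b ^ (2 * min \<alpha> d) - real b)) powr lam)
         ((real b - 1) / (real b powr (2 * lam * real (min \<alpha> d)) - real b))"

definition G_const :: "nat \<Rightarrow> nat \<Rightarrow> nat \<Rightarrow> real \<Rightarrow> nat \<Rightarrow> real" where
  "G_const b \<alpha> d lam a = D_tilde \<alpha> b d powr lam * (- 1 + (1 + C_lambda b \<alpha> d lam) ^ a)"

lemma mu1_eqI: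
  assumes "1 \<le> a" "b ^ (a - 1) \<le> l" "l < b ^ a" "b \<ge> 2"
  shows "mu1 b l = a"
  unfolding mu1_def
proof (rule the_equality)
  fix a' assume a': "1 \<le> a' \<and> b ^ (a' - 1) \<le> l \<and> l < b ^ a'"
  have "b ^ (a' - 1) < b ^ a" "b ^ (a - 1) < b ^ a'"
    using a' assms by linarith+
  then have "a' - 1 < a" "a - 1 < a'"
    using assms(4) by (simp_all add: power_strict_increasing_iff)
  then show "a' = a"
    using a' assms(1) by linarith
qed (use assms in auto)

lemma mu1_bounds:
  assumes "b \<ge> 2" "l \<ge> 1"
  shows "1 \<le> mu1 b l" "b ^ (mu1 b l - 1) \<le> l" "l < b ^ mu1 b l"
proof -
  let ?a = "floorlog b l"
  have *: "b ^ (?a - 1) \<le> l" "l < b ^ ?a"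
    using floorlog_bounds[of l b] assms by auto
  moreover have "1 \<le> ?a"
    using *(2) assms by (cases ?a) auto
  ultimately show "1 \<le> mu1 b l" "b ^ (mu1 b l - 1) \<le> l" "l < b ^ mu1 b l"
    using mu1_eqI[of ?a b l] assms by auto
qed

lemma summable_r_weight:
  assumes "b \<ge> 2" "\<alpha> \<ge> 1" "d \<ge> 1"
  shows "(\<lambda>l. norm (r_weight b \<alpha> d l)) summable_on {1..}"
proof (rule summable_on_comparison_test)
  have "summable (\<lambda>n. norm (inverse (real n ^ 2)))"
    using inverse_power_summable[of 2, where 'a = real] by simp
  then have "(\<lambda>n. inverse (real n ^ 2)) summable_on UNIV"
    by (rule norm_summable_imp_summable_on)
  then show "(\<lambda>n. inverse (real n ^ 2)) summable_on {1..}"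
    by (rule summable_on_subset_banach) auto
next
  fix l :: nat assume l: "l \<in> {1..}"
  define e where "e = 2 * min \<alpha> d * mu1 b l + \<alpha>"
  have "real l ^ 2 \<le> (real b ^ mu1 b l) ^ 2"
    using mu1_bounds(3)[of b l] l assms
    by (intro power_mono) (auto simp flip: of_nat_power)
  also have "\<dots> = real b ^ (mu1 b l * 2)"
    by (simp add: power_mult)
  also have "\<dots> \<le> real b ^ e"
  proof (rule power_increasing)
    have "1 * mu1 b l \<le> min \<alpha> d * mu1 b l"
      using assms by (intro mult_right_mono) auto
    then show "mu1 b l * 2 \<le> e"
      unfolding e_def by linarith
  qed (use assms in auto)
  finally have "inverse (real b ^ e) \<le> inverse (real l ^ 2)"
    using l by (intro le_imp_inverse_le) auto
  moreover have "r_weight b \<alpha> d l = real b powi (- int e)"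
    unfolding r_weight_def e_def by (rule arg_cong[where f = "\<lambda>x. real b powi x"]) simp
  ultimately show "norm (r_weight b \<alpha> d l) \<le> inverse (real l ^ 2)"
    by (simp add: power_int_minus)
qed auto

lemma summable_prod_r_weight:
  assumes "b \<ge> 2" "\<alpha> \<ge> 1" "d \<ge> 1" "finite w" "A \<subseteq> w \<rightarrow>\<^sub>E {1..}"
  shows "(\<lambda>l. \<Prod>j\<in>w. r_weight b \<alpha> d (l j)) summable_on A"
proof -
  have "Infinite_Set_Sum.abs_summable_on (\<lambda>l. \<Prod>j\<in>w. r_weight b \<alpha> d (l j)) (w \<rightarrow>\<^sub>E {1..})"
    using summable_r_weight[OF assms(1-3)] assms(4)
    by (intro abs_summable_on_prod_PiE) (simp_all only: abs_summable_equivalent countableI_type)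
  then have "(\<lambda>l. \<Prod>j\<in>w. r_weight b \<alpha> d (l j)) summable_on (w \<rightarrow>\<^sub>E {1..})"
    unfolding abs_summable_equivalent[symmetric] by (rule abs_summable_summable)
  then show ?thesis
    using assms(5) by (rule summable_on_subset_banach)
qed

end

theory Submission
  imports Defs "HOL-Computational_Algebra.Polynomial_Factorial"
begin

text \<open>
  Write \<open>S\<close> for the sum of \<open>r_weight b \<alpha> d l powr lam\<close> over \<open>l \<ge> 1\<close>; it is a geometric series and
  equals the second entry of the maximum in \<open>C_lambda\<close>. Passing from \<open>r - 1\<close> to \<open>r\<close> components adds to
  the criterion the terms \<open>\<Theta>\<close> of the sets \<open>w\<close> containing \<open>r\<close>, and the algorithm minimizes \<open>\<Theta>\<close>. Hence
  \<open>\<Theta> powr lam\<close> at the chosen component is at most its mean over the \<open>b ^ m - 1\<close> candidates, and by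
  subadditivity of \<open>t powr lam\<close> the power can be moved inside all sums. For fixed remaining entries of
  \<open>l\<close>, the last entries occurring for the various candidates are either multiples of \<open>b ^ m\<close>, whose
  total weight is at most \<open>S / (b ^ m - 1)\<close> because \<open>2 * lam * min \<alpha> d > 1\<close>, or form disjoint sets for
  distinct candidates; both cases contribute at most \<open>S\<close>. By induction, \<open>B_crit\<close> to the power \<open>lam\<close> is
  at most \<open>1 / (b ^ m - 1)\<close> times a sum over all nonempty \<open>w\<close> with weights \<open>S ^ card w\<close>, and grouping
  the \<open>w\<close> by \<open>\<phi> s d w\<close> turns each full block into a factor \<open>(1 + S) ^ d - 1\<close>.
\<close>

section \<open>Powers of sums and sums of weights\<close>

text \<open>Dividing by \<open>x + y\<close> reduces the claim to two fractions in the unit interval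
  that add up to 1, and there \<open>t\<close> is at most \<open>t powr a\<close>.\<close>

lemma powr_subadditive:
  fixes x y a :: real
  assumes "x \<ge> 0" "y \<ge> 0" "0 < a" "a \<le> 1"
  shows "(x + y) powr a \<le> x powr a + y powr a"
proof (cases "x + y = 0")
  case True
  then show ?thesis using assms by simp
next
  case False
  then have pos: "x + y > 0" using assms by simp
  have *: "t \<le> t powr a" if "0 \<le> t" "t \<le> 1" for t :: real
    using powr_mono'[of a 1 t] that assms by simp
  have "1 = x / (x + y) + y / (x + y)"
    using False by (simp add: add_divide_distrib[symmetric])
  also have "\<dots> \<le> (x / (x + y)) powr a + (y / (x + y)) powr a"
    using pos assms by (intro add_mono *) auto
  also have "\<dots> = (x powr a + y powr a) / (x + y) powr a"
    using pos assms by (simp add: powr_divide add_divide_distrib)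
  finally show ?thesis
    using pos by (simp add: field_simps)
qed

lemma powr_sum_le:
  fixes f :: "'a \<Rightarrow> real"
  assumes "\<And>x. x \<in> A \<Longrightarrow> f x \<ge> 0" "0 < a" "a \<le> 1"
  shows "(\<Sum>x\<in>A. f x) powr a \<le> (\<Sum>x\<in>A. f x powr a)"
  using assms(1)
proof (induction A rule: infinite_finite_induct)
  case (insert x A)
  have "(\<Sum>x\<in>insert x A. f x) powr a \<le> f x powr a + (\<Sum>x\<in>A. f x) powr a"
    using insert assms by (auto intro!: powr_subadditive sum_nonneg)
  then show ?case using insert by fastforce
qed (use assms in auto)

text \<open>The finite case bounds every partial sum of \<open>f\<close>. Raising that bound to the
  power \<open>1 / a\<close> turns it into one on the partial sum itself, uniform in the finite set,
  so it passes to the infinite sum.\<close>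

lemma powr_infsum_le:
  fixes f :: "'a \<Rightarrow> real"
  assumes "\<And>x. x \<in> A \<Longrightarrow> f x \<ge> 0" "0 < a" "a \<le> 1"
    and f: "f summable_on A" and fa: "(\<lambda>x. f x powr a) summable_on A"
  shows "infsum f A powr a \<le> infsum (\<lambda>x. f x powr a) A"
proof -
  have "infsum f A \<le> infsum (\<lambda>x. f x powr a) A powr (1 / a)"
  proof (rule infsum_le_finite_sums[OF f])
    fix F assume F: "finite F" "F \<subseteq> A"
    have nn: "sum f F \<ge> 0" using F assms by (auto intro!: sum_nonneg)
    have "sum f F powr a \<le> (\<Sum>x\<in>F. f x powr a)"
      using F assms by (intro powr_sum_le) auto
    also have "\<dots> \<le> infsum (\<lambda>x. f x powr a) A"
      by (rule finite_sum_le_infsum[OF fa]) (use F in auto)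
    finally have "(sum f F powr a) powr (1 / a) \<le> infsum (\<lambda>x. f x powr a) A powr (1 / a)"
      using assms by (intro powr_mono2) auto
    then show "sum f F \<le> infsum (\<lambda>x. f x powr a) A powr (1 / a)"
      using nn assms by (simp add: powr_powr)
  qed
  then have "infsum f A powr a \<le> (infsum (\<lambda>x. f x powr a) A powr (1 / a)) powr a"
    using assms by (intro powr_mono2 infsum_nonneg) auto
  also have "\<dots> = infsum (\<lambda>x. f x powr a) A"
    using assms by (simp add: powr_powr infsum_nonneg)
  finally show ?thesis .
qed

section \<open>Geometric series of weights that depend only on the number of digits\<close>

text \<open>Grouping \<open>l\<close> by its number of digits, the block \<open>B n\<close> has
  \<open>(b - 1) * b ^ n\<close> elements, all with \<open>mu1 b l = Suc n\<close>. The block sums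
  form a geometric series of ratio \<open>b * x\<close>.\<close>

lemma has_sum_power_mu1:
  fixes x :: real
  assumes b: "b \<ge> 2" and x: "0 \<le> x" "real b * x < 1"
  shows "((\<lambda>l. x ^ mu1 b l) has_sum ((real b - 1) * x / (1 - real b * x))) {1..}"
proof -
  define B where "B = (\<lambda>n. {b ^ n..<b ^ Suc n})"
  define g where "g = (\<lambda>n. ((real b - 1) * x) * (real b * x) ^ n)"
  have mu: "mu1 b l = Suc n" if "l \<in> B n" for n l
    using that b by (intro mu1_eqI) (auto simp: B_def)
  have row: "((\<lambda>l. x ^ Suc n) has_sum g n) (B n)" for n
  proof (rule has_sum_finiteI)
    have "b ^ n \<le> b ^ Suc n" using b by simp
    then have "real (b ^ Suc n - b ^ n) = real b ^ Suc n - real b ^ n"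
      by (simp add: of_nat_diff)
    moreover have "(\<Sum>l\<in>B n. x ^ Suc n) = real (b ^ Suc n - b ^ n) * x ^ Suc n"
      by (simp add: B_def)
    ultimately show "g n = (\<Sum>l\<in>B n. x ^ Suc n)"
      by (simp only:) (simp add: g_def algebra_simps power_mult_distrib)
  qed (simp add: B_def)
  have gnn: "g n \<ge> 0" for n using b x by (simp add: g_def)
  have gs: "g sums ((real b - 1) * x * (1 / (1 - real b * x)))"
    unfolding g_def using b x by (intro sums_mult geometric_sums) auto
  then have gsum: "(g has_sum ((real b - 1) * x / (1 - real b * x))) UNIV"
    using sums_nonneg_imp_has_sum[OF gs gnn] by simp
  have "((\<lambda>(n, l). x ^ Suc n) has_sum ((real b - 1) * x / (1 - real b * x))) (Sigma UNIV B)"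
  proof (rule has_sum_SigmaI[OF _ gsum])
    show "(\<lambda>(n, l). x ^ Suc n) summable_on Sigma UNIV B"
      by (rule summable_on_SigmaI[OF _ has_sum_imp_summable[OF gsum]]) (use row x in auto)
  qed (use row in auto)
  also have "?this \<longleftrightarrow> ?thesis"
  proof (rule has_sum_reindex_bij_witness[where j = snd and i = "\<lambda>l. (mu1 b l - 1, l)"])
    fix l :: nat assume "l \<in> {1..}"
    then show "(mu1 b l - 1, l) \<in> Sigma UNIV B"
      using mu1_bounds[OF b, of l] by (cases "mu1 b l") (auto simp: B_def)
  next
    fix z assume "z \<in> Sigma UNIV B"
    moreover have "1 \<le> b ^ n" for n using b by simp
    ultimately show "snd z \<in> {1..}" 
      by (force simp: B_def intro: order_trans)
  qed (auto simp: mu)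
  finally show ?thesis .
qed

lemma mu1_shift:
  assumes "b \<ge> 2" "l \<ge> 1"
  shows "mu1 b (b ^ m * l) = m + mu1 b l"
proof (rule mu1_eqI)
  note * = mu1_bounds[OF assms]
  have "b ^ (m + mu1 b l - 1) = b ^ m * b ^ (mu1 b l - 1)"
    using *(1) by (simp flip: power_add)
  then show "b ^ (m + mu1 b l - 1) \<le> b ^ m * l" using *(2) by simp
  show "b ^ m * l < b ^ (m + mu1 b l)" using *(3) assms by (simp add: power_add)
qed (use assms mu1_bounds[OF assms] in auto)

text \<open>Multiplication by \<open>b ^ m\<close> maps the positive integers onto the positive
  multiples of \<open>b ^ m\<close> and appends \<open>m\<close> digits, which costs the factor
  \<open>x ^ m\<close>.\<close>

lemma has_sum_power_mu1_multiples:
  fixes x :: real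
  assumes b: "b \<ge> 2" and x: "0 \<le> x" "real b * x < 1"
  shows "((\<lambda>l. x ^ mu1 b l) has_sum (x ^ m * ((real b - 1) * x / (1 - real b * x))))
           {l \<in> {1..}. b ^ m dvd l}"
proof -
  have "((\<lambda>l. x ^ m * x ^ mu1 b l) has_sum (x ^ m * ((real b - 1) * x / (1 - real b * x)))) {1..}"
    by (intro has_sum_cmult_right has_sum_power_mu1 assms)
  also have "?this \<longleftrightarrow> ?thesis"
    by (rule has_sum_reindex_bij_witness[where j = "\<lambda>l. b ^ m * l" and i = "\<lambda>l. l div b ^ m"])
       (use b in \<open>auto simp: mu1_shift power_add dvd_imp_le Suc_le_eq elim!: dvdE\<close>)
  finally show ?thesis .
qed

section \<open>Interchange of finite and infinite sums\<close>

lemma sum_infsum_disjoint: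
  fixes f :: "'a \<Rightarrow> real"
  assumes "finite R" "\<And>q. q \<in> R \<Longrightarrow> f summable_on X q"
    and "\<And>q q'. q \<in> R \<Longrightarrow> q' \<in> R \<Longrightarrow> q \<noteq> q' \<Longrightarrow> X q \<inter> X q' = {}"
  shows "(f has_sum (\<Sum>q\<in>R. infsum f (X q))) (\<Union>q\<in>R. X q)"
  using assms
proof (induction R rule: finite_induct)
  case (insert q R)
  have "(f has_sum (infsum f (X q) + (\<Sum>q\<in>R. infsum f (X q)))) (X q \<union> (\<Union>q\<in>R. X q))"
  proof (rule has_sum_Un_disjoint)
    show "X q \<inter> (\<Union>q\<in>R. X q) = {}" using insert.prems(2)[of q] insert.hyps by blast
  qed (use insert in auto)
  then show ?case using insert by simp
qed simp

lemma has_sum_finite_sum: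
  fixes f :: "'q \<Rightarrow> 'a \<Rightarrow> real"
  assumes "\<And>q. q \<in> R \<Longrightarrow> (f q has_sum S q) A"
  shows "((\<lambda>x. \<Sum>q\<in>R. f q x) has_sum (\<Sum>q\<in>R. S q)) A"
  using assms by (induction R rule: infinite_finite_induct) (auto intro!: has_sum_add)

text \<open>Meant for an index split into its last entry \<open>x\<close> and the remaining entries
  \<open>l\<close>, with \<open>q\<close> running through the candidates. Summing over
  \<open>x\<close> first and moving the finite sum over \<open>q\<close> inside leaves, for each
  \<open>l\<close>, exactly the quantity bounded by \<open>le\<close>.\<close>

lemma sum_infsum_fibres_le:
  fixes F :: "'l \<Rightarrow> real" and \<rho> :: "'x \<Rightarrow> real"
  assumes "finite R" and F: "F summable_on L" "\<And>l. l \<in> L \<Longrightarrow> F l \<ge> 0"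
    and \<rho>: "\<rho> summable_on X" "\<And>x. x \<in> X \<Longrightarrow> \<rho> x \<ge> 0"
    and le: "\<And>l. l \<in> L \<Longrightarrow> (\<Sum>q\<in>R. infsum \<rho> {x \<in> X. P q l x}) \<le> S"
  shows "(\<Sum>q\<in>R. \<Sum>\<^sub>\<infinity>(l, x)\<in>(SIGMA l:L. {x \<in> X. P q l x}). F l * \<rho> x) \<le> S * infsum F L"
proof -
  define h where "h = (\<lambda>q l. infsum \<rho> {x \<in> X. P q l x})"
  have \<rho>': "\<rho> summable_on {x \<in> X. P q l x}" for q l
    using \<rho>(1) by (rule summable_on_subset_banach) auto
  have h: "0 \<le> h q l" "h q l \<le> infsum \<rho> X" for q l
    unfolding h_def using \<rho> \<rho>' by (auto intro!: infsum_nonneg infsum_mono_neutral)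
  \<comment> \<open>Each fibre sum is at most the full sum of \<rho>, so a constant multiple of
    \<open>F\<close> dominates.\<close>
  have Fh: "(\<lambda>l. F l * h q l) summable_on L" for q
    by (rule summable_on_comparison_test[OF summable_on_cmult_left[OF F(1), of "infsum \<rho> X"]])
       (use F h in \<open>auto intro!: mult_left_mono\<close>)
  have 1: "(\<Sum>\<^sub>\<infinity>(l, x)\<in>(SIGMA l:L. {x \<in> X. P q l x}). F l * \<rho> x) = (\<Sum>\<^sub>\<infinity>l\<in>L. F l * h q l)" for q
  proof -
    have "(\<lambda>(l, x). F l * \<rho> x) summable_on (SIGMA l:L. {x \<in> X. P q l x})"
      by (rule summable_on_SigmaI[OF _ Fh[of q]])
         (use F \<rho> \<rho>' in \<open>auto simp: h_def intro!: has_sum_cmult_right\<close>)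
    then show ?thesis
      by (subst infsum_Sigma_banach[symmetric]) (simp_all add: h_def infsum_cmult_right')
  qed
  have swap: "((\<lambda>l. \<Sum>q\<in>R. F l * h q l) has_sum (\<Sum>q\<in>R. \<Sum>\<^sub>\<infinity>l\<in>L. F l * h q l)) L"
    using Fh by (intro has_sum_finite_sum) auto
  then have "(\<Sum>q\<in>R. \<Sum>\<^sub>\<infinity>l\<in>L. F l * h q l) = (\<Sum>\<^sub>\<infinity>l\<in>L. \<Sum>q\<in>R. F l * h q l)"
    by (simp add: infsumI)
  also have "\<dots> \<le> (\<Sum>\<^sub>\<infinity>l\<in>L. F l * S)"
  proof (rule infsum_mono)
    show "(\<lambda>l. \<Sum>q\<in>R. F l * h q l) summable_on L"
      using swap by (rule has_sum_imp_summable)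
    show "(\<lambda>l. F l * S) summable_on L"
      by (intro summable_on_cmult_left F)
  next
    fix l assume "l \<in> L"
    then show "(\<Sum>q\<in>R. F l * h q l) \<le> F l * S"
      using le F by (auto simp: h_def sum_distrib_left[symmetric] intro!: mult_left_mono)
  qed
  finally show ?thesis by (simp add: 1 infsum_cmult_left' mult.commute[of S])
qed

section \<open>Polynomials over the prime field and the dual net\<close>

lemma coeff_tr: "coeff (tr b m k) i = (if i < m then of_nat ((k div b ^ i) mod b) else 0)"
  by (auto simp: tr_def coeff_sum coeff_monom if_distrib sum.delta cong: if_cong)

lemma degree_tr_less: "m \<ge> 1 \<Longrightarrow> degree (tr b m k :: 'k::field poly) < m"
  by (rule degree_lessI) (auto simp: coeff_tr)

lemma tr_zero [simp]: "tr b m 0 = 0"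
  by (simp add: tr_def)

text \<open>Translation by 1 permutes the field, so the sum of all elements does not change when 1
  is added to each of the \<open>b\<close> summands. Hence \<open>b\<close> vanishes in the field,
  and being prime it is the characteristic.\<close>

lemma of_nat_eq_0_imp_card_dvd:
  fixes b :: nat
  assumes "prime b" "CARD('k::{field, finite}) = b" "(of_nat n :: 'k) = 0"
  shows "b dvd n"
proof -
  have "(\<Sum>x\<in>UNIV. x) = (\<Sum>x\<in>UNIV. x + (1 :: 'k))"
    by (rule sum.reindex_bij_witness[of _ "\<lambda>x. x + 1" "\<lambda>x. x - 1"]) auto
  then have "(of_nat b :: 'k) = 0"
    by (simp add: sum.distrib assms(2))
  then have "CHAR('k) dvd b" by (simp add: of_nat_eq_0_iff_char_dvd)
  moreover have "CHAR('k) \<noteq> 1" by simp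
  ultimately have "CHAR('k) = b" using assms(1) by (metis prime_nat_iff)
  then show ?thesis using assms(3) by (simp add: of_nat_eq_0_iff_char_dvd)
qed

text \<open>All of the lowest \<open>m\<close> digits of \<open>k\<close> are zero, and the
  induction strips off one factor \<open>b\<close> per digit.\<close>

lemma tr_eq_0_imp_dvd:
  fixes b :: nat
  assumes "prime b" "CARD('k::{field, finite}) = b" "(tr b m k :: 'k poly) = 0"
  shows "b ^ m dvd k"
proof -
  have digit: "b dvd k div b ^ i" if "i < m" for i
  proof -
    have "(of_nat (k div b ^ i mod b) :: 'k) = 0"
      using assms(3) that by (metis coeff_0 coeff_tr)
    then have "b dvd k div b ^ i mod b"
      by (rule of_nat_eq_0_imp_card_dvd[OF assms(1,2)])
    then show ?thesis by (simp add: dvd_mod_iff)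
  qed
  have "b ^ i dvd k" if "i \<le> m" for i
    using that
  proof (induction i)
    case (Suc i)
    then obtain c where c: "k = b ^ i * c" by auto
    have "b > 0" using assms(1) by (simp add: prime_gt_0_nat)
    then have "b dvd c" using digit[of i] Suc.prems c by simp
    then show ?case using c by (auto simp: mult_ac)
  qed simp
  then show ?thesis by simp
qed

text \<open>Stated through coefficients rather than \<open>degree q < m\<close>, so that the zero
  polynomial is counted even for \<open>m = 0\<close> and coefficient vectors correspond bijectively
  to polynomials.\<close>

lemma card_bounded_polys:
  "card {q :: 'k::{field, finite} poly. \<forall>i\<ge>m. coeff q i = 0} = CARD('k) ^ m"
proof -
  let ?P = "{q :: 'k poly. \<forall>i\<ge>m. coeff q i = 0}"
  have "bij_betw (\<lambda>q. restrict (coeff q) {..<m}) ?P ({..<m} \<rightarrow>\<^sub>E UNIV)"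
    by (rule bij_betw_byWitness[where f' = "\<lambda>f. \<Sum>i<m. monom (f i) i"])
       (auto simp: coeff_sum poly_eq_iff fun_eq_iff PiE_def extensional_def)
  then have "card ?P = card ({..<m} \<rightarrow>\<^sub>E (UNIV :: 'k set))"
    by (rule bij_betw_same_card)
  then show ?thesis by (simp add: card_funcsetE)
qed

lemma
  assumes "m \<ge> 1"
  shows finite_nonzero_polys: "finite (nonzero_polys m :: 'k::{field, finite} poly set)"
    and card_nonzero_polys: "card (nonzero_polys m :: 'k poly set) = CARD('k) ^ m - 1"
proof -
  let ?P = "{q :: 'k poly. \<forall>i\<ge>m. coeff q i = 0}"
  have eq: "(nonzero_polys m :: 'k poly set) = ?P - {0}"
    using assms by (auto simp: nonzero_polys_def coeff_eq_0 intro: degree_lessI)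
  have "card ?P > 0" unfolding card_bounded_polys by simp
  then have "finite ?P" by (rule card_ge_0_finite)
  then show "finite (nonzero_polys m :: 'k poly set)" by (simp add: eq)
  show "card (nonzero_polys m :: 'k poly set) = CARD('k) ^ m - 1"
    unfolding eq by (subst card_Diff_singleton) (simp_all add: card_bounded_polys)
qed

lemma dvd_degree_less_imp_eq_0:
  fixes p q :: "'k::field poly"
  assumes "p dvd q" "degree q < degree p"
  shows "q = 0"
  using dvd_imp_degree_le[OF assms(1)] assms(2) by (meson not_le)

text \<open>Here \<open>a\<close> stands for the contribution of the entries held fixed. The
  hypothesis \<open>le\<close> serves the case \<open>p dvd a\<close>, where each of the
  \<open>b ^ m - 1\<close> candidates costs at most the total weight of the multiples of
  \<open>b ^ m\<close>.\<close>

lemma sum_infsum_dual_le: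
  fixes p a :: "'k::{field, finite} poly" and \<rho> :: "nat \<Rightarrow> real"
  assumes b: "prime b" "CARD('k) = b" and p: "irreducible p" "degree p = m" "m \<ge> 1"
    and \<rho>: "\<rho> summable_on {1..}" "\<And>l. \<rho> l \<ge> 0"
    and le: "(real b ^ m - 1) * infsum \<rho> {l \<in> {1..}. b ^ m dvd l} \<le> infsum \<rho> {1..}"
  shows "(\<Sum>q\<in>nonzero_polys m. infsum \<rho> {l \<in> {1..}. p dvd a + tr b m l * q}) \<le> infsum \<rho> {1..}"
proof -
  define R where "R = (nonzero_polys m :: 'k poly set)"
  have R: "finite R" unfolding R_def using p(3) by (rule finite_nonzero_polys)
  have bm: "b ^ m \<ge> 1" using b(1) by (simp add: prime_gt_0_nat Suc_le_eq)
  have cardR: "real (card R) = real b ^ m - 1"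
    unfolding R_def card_nonzero_polys[OF p(3)] b(2) using bm by (simp add: of_nat_diff)
  have prime: "prime_elem p" using p(1) by (rule field_poly_irreducible_imp_prime)
  have \<rho>': "\<rho> summable_on Q" if "Q \<subseteq> {1..}" for Q
    using \<rho>(1) that by (rule summable_on_subset_banach)
  have tr0: "tr b m l = (0 :: 'k poly)" if "p dvd tr b m l" for l
    using that degree_tr_less[of m b l, where 'k = 'k] p by (intro dvd_degree_less_imp_eq_0) auto
  show ?thesis
  proof (cases "p dvd a")
    case True
    \<comment> \<open>Every \<open>q\<close> is invertible modulo \<open>p\<close>, so only multiples of \<open>b ^ m\<close> occur.\<close>
    have "infsum \<rho> {l \<in> {1..}. p dvd a + tr b m l * q} \<le> infsum \<rho> {l \<in> {1..}. b ^ m dvd l}"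
      if q: "q \<in> R" for q
    proof (rule infsum_mono2)
      show "{l \<in> {1..}. p dvd a + tr b m l * q} \<subseteq> {l \<in> {1..}. b ^ m dvd l}"
      proof safe
        fix l assume "p dvd a + tr b m l * q"
        then have "p dvd tr b m l * q" using True by (simp add: dvd_add_right_iff)
        moreover have "\<not> p dvd q"
          using q p dvd_degree_less_imp_eq_0[of p q] by (auto simp: R_def nonzero_polys_def)
        ultimately show "b ^ m dvd l"
          using prime tr_eq_0_imp_dvd[OF b tr0] by (auto simp: prime_elem_dvd_mult_iff)
      qed
    qed (auto intro!: \<rho>' \<rho>(2))
    then have "(\<Sum>q\<in>R. infsum \<rho> {l \<in> {1..}. p dvd a + tr b m l * q}) \<le>
        (\<Sum>q\<in>R. infsum \<rho> {l \<in> {1..}. b ^ m dvd l})"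
      by (rule sum_mono)
    also have "\<dots> \<le> infsum \<rho> {1..}" using le by (simp add: cardR)
    finally show ?thesis by (simp add: R_def)
  next
    case False
    let ?X = "\<lambda>q. {l \<in> {1..}. p dvd a + tr b m l * q}"
    have "(\<rho> has_sum (\<Sum>q\<in>R. infsum \<rho> (?X q))) (\<Union>q\<in>R. ?X q)"
    \<comment> \<open>An \<open>l\<close> shared by two candidates makes \<open>p\<close> divide
      \<open>tr b m l * (q - q')\<close>. The second factor is nonzero of degree below
      \<open>m\<close>, so \<open>tr b m l = 0\<close>, and then \<open>p\<close> would divide
      \<open>a\<close>.\<close>
    proof (rule sum_infsum_disjoint[OF R])
      fix q q' assume q: "q \<in> R" "q' \<in> R" "q \<noteq> q'"
      show "?X q \<inter> ?X q' = {}"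
      proof (rule ccontr)
        assume "?X q \<inter> ?X q' \<noteq> {}"
        then obtain l where l: "p dvd a + tr b m l * q" "p dvd a + tr b m l * q'" by auto
        then have "p dvd (a + tr b m l * q) - (a + tr b m l * q')" by (rule dvd_diff)
        then have "p dvd tr b m l * (q - q')" by (simp add: algebra_simps)
        moreover have "\<not> p dvd q - q'"
        proof
          assume "p dvd q - q'"
          moreover have "degree (q - q') < degree p"
            using q p degree_diff_less[of q m q'] by (auto simp: R_def nonzero_polys_def)
          ultimately have "q - q' = 0" by (rule dvd_degree_less_imp_eq_0)
          then show False using q by simp
        qed
        ultimately have "tr b m l = (0 :: 'k poly)"
          using prime by (intro tr0) (simp add: prime_elem_dvd_mult_iff)
        then show False using l(1) False by simp
      qed
    qed (auto intro!: \<rho>')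
    then have "(\<Sum>q\<in>R. infsum \<rho> (?X q)) = infsum \<rho> (\<Union>q\<in>R. ?X q)"
      by (simp add: infsumI)
    also have "\<dots> \<le> infsum \<rho> {1..}"
      by (rule infsum_mono2) (auto intro!: \<rho>' \<rho>(2))
    finally show ?thesis by (simp add: R_def)
  qed
qed

lemma zero_pad_in_dual_net_iff:
  fixes p :: "'k::{field, finite} poly"
  assumes "w \<subseteq> {1..r}"
  shows "zero_pad r w l \<in> dual_net b r q p \<longleftrightarrow> p dvd (\<Sum>j\<in>w. tr b (degree p) (l j) * q j)"
proof -
  have "(\<Sum>j\<in>{1..r}. tr b (degree p) (zero_pad r w l j) * q j) =
        (\<Sum>j\<in>w. tr b (degree p) (l j) * q j)"
    using assms by (intro sum.mono_neutral_cong_right) (auto simp: zero_pad_def)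
  then show ?thesis
    by (simp add: dual_net_def zero_pad_def cong_0_iff)
qed

section \<open>The inner sums of the criterion\<close>

text \<open>The inner sum of \<open>B_crit\<close> with the zero padding removed: it no longer
  mentions \<open>r\<close>, so criteria for different lengths share their terms.\<close>

definition dual_sum :: "nat \<Rightarrow> nat \<Rightarrow> nat \<Rightarrow> 'k::field poly \<Rightarrow> (nat \<Rightarrow> 'k poly) \<Rightarrow> nat set \<Rightarrow> real" where
  "dual_sum b \<alpha> d p q w =
     (\<Sum>\<^sub>\<infinity>l\<in>{l \<in> w \<rightarrow>\<^sub>E {1..}. p dvd (\<Sum>j\<in>w. tr b (degree p) (l j) * q j)}.
        \<Prod>j\<in>w. r_weight b \<alpha> d (l j))"

lemma B_crit_eq:
  fixes p :: "'k::{field, finite} poly"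
  shows "B_crit b s \<alpha> d \<gamma> r q p =
    (\<Sum>w\<in>Pow {1..r} - {{}}. \<gamma> (\<phi> s d w) * D_tilde \<alpha> b d ^ card (\<phi> s d w) * dual_sum b \<alpha> d p q w)"
  unfolding B_crit_def dual_sum_def
  by (intro sum.cong refl arg_cong2[of _ _ _ _ "(*)"] infsum_cong_neutral)
     (auto simp: zero_pad_in_dual_net_iff)

lemma dual_sum_cong:
  "(\<And>j. j \<in> w \<Longrightarrow> q j = q' j) \<Longrightarrow> dual_sum b \<alpha> d p q w = dual_sum b \<alpha> d p q' w"
  unfolding dual_sum_def by (auto intro!: infsum_cong_neutral cong: sum.cong)

lemma r_weight_nonneg: "r_weight b \<alpha> d l \<ge> 0"
  by (simp add: r_weight_def)

lemma dual_sum_nonneg: "dual_sum b \<alpha> d p q w \<ge> 0"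
  unfolding dual_sum_def by (intro infsum_nonneg prod_nonneg) (auto simp: r_weight_nonneg)

text \<open>Isolates a base that does not depend on \<open>l\<close>, the form required by the
  geometric series in \<open>mu1 b l\<close>.\<close>

lemma r_weight_powr:
  assumes "b \<ge> 1"
  shows "r_weight b \<alpha> d l powr lam =
    real b powr (- (real \<alpha> * lam)) * (real b powr (- (2 * lam * real (min \<alpha> d)))) ^ mu1 b l"
proof -
  have "r_weight b \<alpha> d l = real b powr (- 2 * real (min \<alpha> d) * real (mu1 b l) - real \<alpha>)"
    using assms unfolding r_weight_def by (subst powr_real_of_int'[symmetric]) auto
  then have "r_weight b \<alpha> d l powr lam =
      real b powr (- (real \<alpha> * lam) + - (2 * lam * real (min \<alpha> d)) * real (mu1 b l))"
    by (simp only: powr_powr, intro arg_cong[where f = "(powr) (real b)"]) (simp add: algebra_simps)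
  also have "\<dots> = real b powr (- (real \<alpha> * lam)) *
      (real b powr (- (2 * lam * real (min \<alpha> d)))) powr real (mu1 b l)"
    by (simp only: powr_add powr_powr)
  finally show ?thesis
    using assms by (simp add: powr_realpow)
qed

section \<open>Subsets of indices grouped by blocks\<close>

lemma sum_Pow_Un_disjoint:
  assumes "A \<inter> B = {}"
  shows "(\<Sum>w\<in>Pow (A \<union> B). f w) = (\<Sum>u\<in>Pow A. \<Sum>v\<in>Pow B. f (u \<union> v))"
  unfolding sum.cartesian_product
  by (rule sum.reindex_bij_witness[where i = "\<lambda>(u, v). u \<union> v" and j = "\<lambda>w. (w \<inter> A, w \<inter> B)"])
     (use assms in \<open>auto simp flip: Int_Un_distrib simp: Int_absorb2\<close>)

lemma sum_Pow_insert:
  assumes "x \<notin> A"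
  shows "(\<Sum>w\<in>Pow (insert x A). f w) = (\<Sum>u\<in>Pow A. f u + f (insert x u))"
  using sum_Pow_Un_disjoint[of A "{x}" f] assms by (simp add: Pow_insert add.commute cong: sum.cong)

lemma sum_Pow_power_card:
  fixes t :: "'a::comm_semiring_1"
  assumes "finite A"
  shows "(\<Sum>w\<in>Pow A. t ^ card w) = (1 + t) ^ card A"
  using assms
proof (induction A rule: finite_induct)
  case (insert x A)
  have "(\<Sum>w\<in>Pow (insert x A). t ^ card w) = (\<Sum>w\<in>Pow A. t ^ card w + t * t ^ card w)"
    unfolding sum_Pow_insert[OF insert.hyps(2)]
    using insert.hyps by (intro sum.cong) (auto simp: card_insert_if finite_subset)
  then show ?case
    using insert by (simp add: sum.distrib sum_distrib_left[symmetric] algebra_simps)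
qed simp

lemma \<phi>_eq_empty_iff:
  assumes "d \<ge> 1" "w \<subseteq> {1..d * s}"
  shows "\<phi> s d w = {} \<longleftrightarrow> w = {}"
proof
  assume e: "\<phi> s d w = {}"
  show "w = {}"
  proof (rule ccontr)
    assume "w \<noteq> {}"
    then obtain i where i: "i \<in> w" "1 \<le> i" "i \<le> d * s" using assms by fastforce
    \<comment> \<open>Blocks are numbered from 1, so \<open>Suc k\<close> is the block that contains
      \<open>i\<close>.\<close>
    define k where "k = (i - 1) div d"
    have "i - 1 = d * k + (i - 1) mod d" "(i - 1) mod d < d"
      using assms(1) by (simp_all add: k_def)
    then have k: "d * k + 1 \<le> i" "i \<le> d * Suc k" using i by auto
    have "d * k < d * s" using k i by linarith
    then have "k < s" by simp
    then have "Suc k \<in> \<phi> s d w" using i k by (auto simp: \<phi>_def)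
    then show False using e by simp
  qed
qed (simp add: \<phi>_def)

text \<open>The set \<open>v\<close> lies inside block \<open>Suc J\<close> because \<open>a\<close>
  is at most \<open>d\<close>. Blocks are disjoint, so only whether \<open>v\<close> is empty
  matters.\<close>

lemma \<phi>_block_Un:
  assumes "w \<subseteq> {1..d * J}" "v \<subseteq> {d * J + 1..d * J + a}" "a \<le> d" "J < s"
  shows "\<phi> s d (w \<union> v) = (if v = {} then \<phi> s d w else insert (Suc J) (\<phi> s d w))"
proof (cases "v = {}")
  case False
  have meets: "v \<inter> {d * (j - 1) + 1..d * j} \<noteq> {} \<longleftrightarrow> j = Suc J" if "j \<ge> 1" for j
  proof
    assume "j = Suc J"
    moreover have "v \<subseteq> {d * J + 1..d * Suc J}" using assms(2,3) by fastforce
    ultimately show "v \<inter> {d * (j - 1) + 1..d * j} \<noteq> {}" using False by (simp add: Int_absorb2)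
  next
    assume "v \<inter> {d * (j - 1) + 1..d * j} \<noteq> {}"
    then obtain i where "d * J + 1 \<le> i" "i \<le> d * J + a" "d * (j - 1) + 1 \<le> i" "i \<le> d * j"
      using assms(2) by fastforce
    then have "d * J < d * j" "d * (j - 1) < d * Suc J"
      using assms(3) unfolding mult_Suc_right by linarith+
    then have "J < j" "j - 1 < Suc J" by (simp_all only: mult_less_cancel1)
    then show "j = Suc J" using that by simp
  qed
  have "\<phi> s d (w \<union> v) = \<phi> s d w \<union> {j \<in> {1..s}. v \<inter> {d * (j - 1) + 1..d * j} \<noteq> {}}"
    unfolding \<phi>_def by blast
  also have "{j \<in> {1..s}. v \<inter> {d * (j - 1) + 1..d * j} \<noteq> {}} = {Suc J}"
    using meets assms(4) by auto
  finally show ?thesis using False by simp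
qed simp

text \<open>All nonempty parts \<open>v\<close> of the last block have the same effect on \<phi>, so
  their powers \<open>t ^ card v\<close> can be added up first, to
  \<open>(1 + t) ^ a - 1\<close>.\<close>

lemma sum_Pow_last_block:
  fixes g :: "nat set \<Rightarrow> real"
  assumes "a \<le> d" "J < s"
  shows "(\<Sum>w\<in>Pow {1..d * J + a}. g (\<phi> s d w) * t ^ card w) =
    (\<Sum>w\<in>Pow {1..d * J}. (g (\<phi> s d w) + ((1 + t) ^ a - 1) * g (insert (Suc J) (\<phi> s d w))) * t ^ card w)"
proof -
  define B where "B = {d * J + 1..d * J + a}"
  have B: "finite B" "card B = a" by (auto simp: B_def)
  have disj: "w \<inter> v = {}" if "w \<subseteq> {1..d * J}" "v \<subseteq> B" for w v
  proof -
    have "{1..d * J} \<inter> B = {}" by (auto simp: B_def)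
    then show ?thesis using that by blast
  qed
  have "(\<Sum>w\<in>Pow {1..d * J + a}. g (\<phi> s d w) * t ^ card w) =
    (\<Sum>w\<in>Pow ({1..d * J} \<union> B). g (\<phi> s d w) * t ^ card w)"
    by (intro sum.cong arg_cong[where f = Pow]) (auto simp: B_def)
  also have "\<dots> = (\<Sum>w\<in>Pow {1..d * J}. \<Sum>v\<in>Pow B. g (\<phi> s d (w \<union> v)) * t ^ card (w \<union> v))"
    by (rule sum_Pow_Un_disjoint) (auto simp: B_def)
  also have "\<dots> = (\<Sum>w\<in>Pow {1..d * J}. (g (\<phi> s d w) + ((1 + t) ^ a - 1) * g (insert (Suc J) (\<phi> s d w))) * t ^ card w)"
  proof (rule sum.cong)
    fix w assume w: "w \<in> Pow {1..d * J}"
    have "(\<Sum>v\<in>Pow B. g (\<phi> s d (w \<union> v)) * t ^ card (w \<union> v)) =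
      (\<Sum>v\<in>Pow B. (if v = {} then g (\<phi> s d w) else g (insert (Suc J) (\<phi> s d w))) * t ^ card w * t ^ card v)"
    proof (rule sum.cong)
      fix v assume v: "v \<in> Pow B"
      have "card (w \<union> v) = card w + card v"
        using w v disj B(1) by (intro card_Un_disjoint) (auto intro: finite_subset)
      then show "g (\<phi> s d (w \<union> v)) * t ^ card (w \<union> v) =
        (if v = {} then g (\<phi> s d w) else g (insert (Suc J) (\<phi> s d w))) * t ^ card w * t ^ card v"
        using \<phi>_block_Un[of w d J v a s] w v assms by (simp add: B_def power_add)
    qed simp
    also have "\<dots> = g (\<phi> s d w) * t ^ card w +
        (\<Sum>v\<in>Pow B - {{}}. g (insert (Suc J) (\<phi> s d w)) * t ^ card w * t ^ card v)"
      using B(1) by (subst sum.remove[of _ "{}"]) (auto intro!: sum.cong)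
    also have "(\<Sum>v\<in>Pow B - {{}}. g (insert (Suc J) (\<phi> s d w)) * t ^ card w * t ^ card v) =
        g (insert (Suc J) (\<phi> s d w)) * t ^ card w * ((1 + t) ^ a - 1)"
      using B by (simp add: sum_distrib_left[symmetric] sum_diff1 sum_Pow_power_card)
    finally show "(\<Sum>v\<in>Pow B. g (\<phi> s d (w \<union> v)) * t ^ card (w \<union> v)) =
        (g (\<phi> s d w) + ((1 + t) ^ a - 1) * g (insert (Suc J) (\<phi> s d w))) * t ^ card w"
      by (simp add: algebra_simps)
  qed simp
  finally show ?thesis .
qed

text \<open>Induction on the number of blocks. Peeling off the last block replaces \<open>g\<close>
  by a combination of \<open>g u\<close> and \<open>g (insert (Suc J) u)\<close>, which is why
  \<open>g\<close> is kept arbitrary.\<close>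

lemma sum_Pow_full_blocks:
  fixes g :: "nat set \<Rightarrow> real"
  assumes "J \<le> s"
  shows "(\<Sum>w\<in>Pow {1..d * J}. g (\<phi> s d w) * t ^ card w) =
    (\<Sum>u\<in>Pow {1..J}. g u * ((1 + t) ^ d - 1) ^ card u)"
  using assms
proof (induction J arbitrary: g)
  case 0
  then show ?case by (simp add: \<phi>_def)
next
  case (Suc J)
  define K where "K = (1 + t) ^ d - 1"
  have "(\<Sum>w\<in>Pow {1..d * Suc J}. g (\<phi> s d w) * t ^ card w) =
    (\<Sum>w\<in>Pow {1..d * J + d}. g (\<phi> s d w) * t ^ card w)"
    by (simp add: add.commute)
  also have "\<dots> = (\<Sum>w\<in>Pow {1..d * J}. (g (\<phi> s d w) + K * g (insert (Suc J) (\<phi> s d w))) * t ^ card w)"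
    unfolding K_def using Suc.prems by (intro sum_Pow_last_block) auto
  also have "\<dots> = (\<Sum>u\<in>Pow {1..J}. (g u + K * g (insert (Suc J) u)) * K ^ card u)"
    using Suc.IH[of "\<lambda>u. g u + K * g (insert (Suc J) u)"] Suc.prems by (simp add: K_def)
  also have "\<dots> = (\<Sum>u\<in>Pow {1..J}. g u * K ^ card u + g (insert (Suc J) u) * K ^ card (insert (Suc J) u))"
  proof (rule sum.cong)
    fix u assume "u \<in> Pow {1..J}"
    then have "card (insert (Suc J) u) = Suc (card u)"
      by (subst card_insert_disjoint) (auto intro: finite_subset)
    then show "(g u + K * g (insert (Suc J) u)) * K ^ card u =
      g u * K ^ card u + g (insert (Suc J) u) * K ^ card (insert (Suc J) u)"
      by (simp add: algebra_simps)
  qed simp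
  also have "\<dots> = (\<Sum>u\<in>Pow {1..Suc J}. g u * K ^ card u)"
    by (simp add: atLeastAtMostSuc_conv sum_Pow_insert)
  finally show ?case by (simp add: K_def)
qed

lemma sum_Pow_blocks:
  fixes g :: "nat set \<Rightarrow> real"
  assumes "a \<le> d" "J < s"
  shows "(\<Sum>w\<in>Pow {1..d * J + a}. g (\<phi> s d w) * t ^ card w) =
    (\<Sum>u\<in>Pow {1..J}. (g u + ((1 + t) ^ a - 1) * g (insert (Suc J) u)) * ((1 + t) ^ d - 1) ^ card u)"
  using sum_Pow_last_block[OF assms, of g t] assms(2)
    sum_Pow_full_blocks[of J s "\<lambda>u. g u + ((1 + t) ^ a - 1) * g (insert (Suc J) u)" d t]
  by simp

text \<open>One non-negative entry of the maximum suffices; the entry for \<nu> equal to \<alpha> is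
  taken.\<close>

lemma D_tilde_nonneg:
  assumes "b \<ge> 2" "\<alpha> \<ge> 1"
  shows "D_tilde \<alpha> b d \<ge> 0"
proof -
  have "pi / real b < pi" using assms(1) by (simp add: field_simps)
  then have sin: "sin (pi / real b) > 0" using assms(1) by (intro sin_gt_zero) auto
  have "0 \<le> C_prime \<alpha> b \<alpha> + C_tilde \<alpha> b / real b ^ (2 * (\<alpha> - \<alpha>))"
    unfolding C_prime_def C_tilde_def using sin by (intro add_nonneg_nonneg sum_nonneg) auto
  also have "\<dots> \<le> D_const \<alpha> b"
    unfolding D_const_def using assms(2) by (intro Max_ge finite_imageI image_eqI[where x = \<alpha>]) auto
  finally show ?thesis by (simp add: D_tilde_def)
qed

section \<open>The component-by-component step\<close>

locale cbc_setting =
  fixes b m \<alpha> d :: nat and lam :: real and p :: "'k::{field, finite} poly"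
  assumes b: "prime b" "CARD('k) = b"
    and m: "m \<ge> 1" and \<alpha>: "\<alpha> \<ge> 1" and d: "d \<ge> 1"
    and p: "irreducible p" "degree p = m"
    and lam: "1 / (2 * real (min \<alpha> d)) < lam" "lam \<le> 1"
begin

definition \<rho> :: "nat \<Rightarrow> real" where "\<rho> l = r_weight b \<alpha> d l powr lam"

definition S :: real where "S = infsum \<rho> {1..}"

definition x :: real where "x = real b powr (- (2 * lam * real (min \<alpha> d)))"

lemma b2: "b \<ge> 2"
  using b(1) by (rule prime_ge_2_nat)

lemma lam_pos: "lam > 0"
  using lam(1) by (rule le_less_trans[rotated]) simp

text \<open>The lower bound on \<open>lam\<close> enters here: it says that
  \<open>2 * lam * min \<alpha> d\<close> exceeds 1, which puts the ratio \<open>b * x\<close> of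
  the geometric series below 1.\<close>

lemma x: "x > 0" "real b * x < 1"
proof -
  show "x > 0" using b2 by (simp add: x_def)
  have "1 < 2 * lam * real (min \<alpha> d)"
    using lam(1) \<alpha> d by (simp add: field_simps)
  then have "real b powr (1 - 2 * lam * real (min \<alpha> d)) < real b powr 0"
    using b2 by (intro powr_less_mono) auto
  then show "real b * x < 1"
    using b2 by (simp add: x_def powr_diff powr_minus field_simps)
qed

lemma \<rho>_eq: "\<rho> = (\<lambda>l. real b powr (- (real \<alpha> * lam)) * x ^ mu1 b l)"
  using b2 by (simp add: fun_eq_iff \<rho>_def x_def r_weight_powr)

lemma \<rho>_nonneg: "\<rho> l \<ge> 0"
  by (simp add: \<rho>_def)

lemma has_sum_\<rho>: "(\<rho> has_sum (real b powr (- (real \<alpha> * lam)) * ((real b - 1) * x / (1 - real b * x)))) {1..}"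
  unfolding \<rho>_eq using b2 x by (intro has_sum_cmult_right has_sum_power_mu1) auto

lemma summable_\<rho>: "\<rho> summable_on {1..}"
  using has_sum_\<rho> by (rule has_sum_imp_summable)

lemma S_eq: "S = real b powr (- (real \<alpha> * lam)) * ((real b - 1) * x / (1 - real b * x))"
  unfolding S_def using has_sum_\<rho> by (rule infsumI)

lemma S_nonneg: "S \<ge> 0"
  unfolding S_def by (intro infsum_nonneg \<rho>_nonneg)

lemma S_le_C_lambda: "S \<le> C_lambda b \<alpha> d lam"
proof -
  have "(real b - 1) * x / (1 - real b * x) = (real b - 1) / (1 / x - real b)"
    using x by (simp add: field_simps)
  also have "1 / x = real b powr (2 * lam * real (min \<alpha> d))"
    using b2 by (simp add: x_def powr_minus field_simps)
  finally show ?thesis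
    using b2 unfolding S_eq C_lambda_def powr_minus_divide by (intro mult_left_mono) auto
qed

text \<open>Restricting to multiples of \<open>b ^ m\<close> scales the sum by \<open>x ^ m\<close>,
  and \<open>(b ^ m - 1) * x ^ m\<close> is at most \<open>(b * x) ^ m\<close>, hence at most
  1.\<close>

lemma multiples_le: "(real b ^ m - 1) * infsum \<rho> {l \<in> {1..}. b ^ m dvd l} \<le> infsum \<rho> {1..}"
proof -
  have "(\<rho> has_sum (real b powr (- (real \<alpha> * lam)) * (x ^ m * ((real b - 1) * x / (1 - real b * x)))))
          {l \<in> {1..}. b ^ m dvd l}"
    unfolding \<rho>_eq using b2 x by (intro has_sum_cmult_right has_sum_power_mu1_multiples) auto
  then have "infsum \<rho> {l \<in> {1..}. b ^ m dvd l} = x ^ m * S"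
    by (simp add: infsumI S_eq)
  then have "(real b ^ m - 1) * infsum \<rho> {l \<in> {1..}. b ^ m dvd l} = ((real b ^ m - 1) * x ^ m) * S"
    by simp
  also have "\<dots> \<le> 1 * S"
  proof (rule mult_right_mono[OF _ S_nonneg])
    have "(real b ^ m - 1) * x ^ m \<le> real b ^ m * x ^ m"
      using x by (intro mult_right_mono) auto
    also have "\<dots> = (real b * x) ^ m" by (simp add: power_mult_distrib)
    also have "\<dots> \<le> 1" using x by (intro power_le_one) auto
    finally show "(real b ^ m - 1) * x ^ m \<le> 1" .
  qed
  finally show ?thesis by (simp add: S_def)
qed

lemma
  assumes "finite w"
  shows summable_prod_\<rho>: "A \<subseteq> w \<rightarrow>\<^sub>E {1..} \<Longrightarrow> (\<lambda>l. \<Prod>j\<in>w. \<rho> (l j)) summable_on A"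
    and infsum_prod_\<rho>: "(\<Sum>\<^sub>\<infinity>l\<in>w \<rightarrow>\<^sub>E {1..}. \<Prod>j\<in>w. \<rho> (l j)) = S ^ card w"
proof -
  have abs: "(\<lambda>l. norm (\<rho> l)) summable_on {1..}"
    using summable_\<rho> by (simp add: \<rho>_nonneg)
  have "Infinite_Set_Sum.abs_summable_on (\<lambda>l. \<Prod>j\<in>w. \<rho> (l j)) (w \<rightarrow>\<^sub>E {1..})"
    using abs assms
    by (intro abs_summable_on_prod_PiE) (simp_all only: abs_summable_equivalent countableI_type)
  then have *: "(\<lambda>l. \<Prod>j\<in>w. \<rho> (l j)) summable_on (w \<rightarrow>\<^sub>E {1..})"
    unfolding abs_summable_equivalent[symmetric] by (rule abs_summable_summable)
  show "A \<subseteq> w \<rightarrow>\<^sub>E {1..} \<Longrightarrow> (\<lambda>l. \<Prod>j\<in>w. \<rho> (l j)) summable_on A"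
    using * by (rule summable_on_subset_banach)
  show "(\<Sum>\<^sub>\<infinity>l\<in>w \<rightarrow>\<^sub>E {1..}. \<Prod>j\<in>w. \<rho> (l j)) = S ^ card w"
    using infsum_prod_PiE_abs[OF assms, of "\<lambda>_. \<rho>" "\<lambda>_. {1..}"] abs by (simp add: S_def)
qed

lemma dual_sum_powr_le:
  assumes "finite w"
  shows "dual_sum b \<alpha> d p q w powr lam \<le>
    (\<Sum>\<^sub>\<infinity>l\<in>{l \<in> w \<rightarrow>\<^sub>E {1..}. p dvd (\<Sum>j\<in>w. tr b m (l j) * q j)}. \<Prod>j\<in>w. \<rho> (l j))"
proof -
  have eq: "(\<Prod>j\<in>w. r_weight b \<alpha> d (l j)) powr lam = (\<Prod>j\<in>w. \<rho> (l j))" for l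
    by (simp add: \<rho>_def prod_powr_distrib r_weight_nonneg)
  show ?thesis
    unfolding dual_sum_def p(2) eq[symmetric]
  proof (rule powr_infsum_le)
    show "(\<lambda>l. \<Prod>j\<in>w. r_weight b \<alpha> d (l j)) summable_on
        {l \<in> w \<rightarrow>\<^sub>E {1..}. p dvd (\<Sum>j\<in>w. tr b m (l j) * q j)}"
      by (rule summable_prod_r_weight) (use b2 \<alpha> d assms in auto)
    show "(\<lambda>l. (\<Prod>j\<in>w. r_weight b \<alpha> d (l j)) powr lam) summable_on
        {l \<in> w \<rightarrow>\<^sub>E {1..}. p dvd (\<Sum>j\<in>w. tr b m (l j) * q j)}"
      unfolding eq by (rule summable_prod_\<rho>) (use assms in auto)
  qed (use lam lam_pos in \<open>auto intro!: prod_nonneg simp: r_weight_nonneg\<close>)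
qed

text \<open>The entry at \<open>n\<close> is separated from the entries on \<open>w\<close>, whose
  contribution to the divisibility condition is \<open>a l\<close>. Summing over the candidates and
  the entry at \<open>n\<close> gives a factor of at most \<open>S\<close> for every
  \<open>l\<close>; the remaining entries give \<open>S ^ card w\<close>.\<close>

lemma sum_dual_sum_le:
  assumes w: "finite w" "n \<notin> w"
  shows "(\<Sum>q'\<in>nonzero_polys m. dual_sum b \<alpha> d p (q(n := q')) (insert n w) powr lam) \<le>
    S ^ card (insert n w)"
proof -
  define a where "a = (\<lambda>l. \<Sum>j\<in>w. tr b m (l j) * q j)"
  have "dual_sum b \<alpha> d p (q(n := q')) (insert n w) powr lam \<le>
    (\<Sum>\<^sub>\<infinity>(l, y)\<in>(SIGMA l:w \<rightarrow>\<^sub>E {1..}. {y \<in> {1..}. p dvd a l + tr b m y * q'}).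
       (\<Prod>j\<in>w. \<rho> (l j)) * \<rho> y)" (is "_ \<le> ?rhs") for q'
  proof -
    let ?E = "{l \<in> insert n w \<rightarrow>\<^sub>E {1..}. p dvd a l + tr b m (l n) * q'}"
    have sumeq: "(\<Sum>j\<in>insert n w. tr b m (l j) * (q(n := q')) j) = a l + tr b m (l n) * q'" for l
    proof -
      have "(\<Sum>j\<in>w. tr b m (l j) * (q(n := q')) j) = a l"
        unfolding a_def using w by (intro sum.cong) auto
      then show ?thesis using w by (simp add: add.commute)
    qed
    have a_upd: "a (l(n := y)) = a l" for l y
      unfolding a_def using w by (intro sum.cong) auto
    have prod_upd: "(\<Prod>j\<in>w. \<rho> ((l(n := y)) j)) = (\<Prod>j\<in>w. \<rho> (l j))" for l y
      using w by (intro prod.cong) auto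
    have "dual_sum b \<alpha> d p (q(n := q')) (insert n w) powr lam \<le>
        (\<Sum>\<^sub>\<infinity>l\<in>?E. \<Prod>j\<in>insert n w. \<rho> (l j))"
      using dual_sum_powr_le[of "insert n w" "q(n := q')"] w(1) unfolding sumeq by simp
    also have "\<dots> = ?rhs"
    \<comment> \<open>Extensional functions on \<open>w\<close> have the value
      \<open>undefined\<close> at \<open>n\<close>, so the value at \<open>n\<close> must be reset
      for the splitting to be a bijection.\<close>
    proof (rule infsum_reindex_bij_witness[where j = "\<lambda>l. (l(n := undefined), l n)" and i = "\<lambda>(l, y). l(n := y)"])
      fix l assume "l \<in> ?E"
      then show "(l(n := undefined), l n) \<in> (SIGMA l:w \<rightarrow>\<^sub>E {1..}. {y \<in> {1..}. p dvd a l + tr b m y * q'})"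
        using w by (auto simp: a_upd intro: fun_upd_in_PiE)
    next
      fix z assume z: "z \<in> (SIGMA l:w \<rightarrow>\<^sub>E {1..}. {y \<in> {1..}. p dvd a l + tr b m y * q'})"
      obtain l y where [simp]: "z = (l, y)" by (cases z)
      have l: "l \<in> w \<rightarrow>\<^sub>E {1..}" using z by auto
      then have "l n = undefined" using w by (auto simp: PiE_def extensional_def)
      then show "(((\<lambda>(l, y). l(n := y)) z)(n := undefined), (\<lambda>(l, y). l(n := y)) z n) = z"
        by (simp add: fun_eq_iff)
      show "(\<lambda>(l, y). l(n := y)) z \<in> ?E"
        using z l by (auto simp: a_upd simp del: fun_upd_apply intro!: PiE_fun_upd) simp_all
    next
      fix l
      show "(case (l(n := undefined), l n) of (l, y) \<Rightarrow> (\<Prod>j\<in>w. \<rho> (l j)) * \<rho> y) = (\<Prod>j\<in>insert n w. \<rho> (l j))"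
        using w by (simp add: prod_upd mult.commute del: fun_upd_apply)
    qed auto
    finally show ?thesis .
  qed
  then have "(\<Sum>q'\<in>nonzero_polys m. dual_sum b \<alpha> d p (q(n := q')) (insert n w) powr lam) \<le>
    (\<Sum>q'\<in>nonzero_polys m. \<Sum>\<^sub>\<infinity>(l, y)\<in>(SIGMA l:w \<rightarrow>\<^sub>E {1..}. {y \<in> {1..}. p dvd a l + tr b m y * q'}).
       (\<Prod>j\<in>w. \<rho> (l j)) * \<rho> y)"
    by (rule sum_mono)
  also have "\<dots> \<le> S * (\<Sum>\<^sub>\<infinity>l\<in>w \<rightarrow>\<^sub>E {1..}. \<Prod>j\<in>w. \<rho> (l j))"
  proof (rule sum_infsum_fibres_le)
    show "(\<Sum>q'\<in>nonzero_polys m. infsum \<rho> {y \<in> {1..}. p dvd a l + tr b m y * q'}) \<le> S" for l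
      unfolding S_def using b p m summable_\<rho> \<rho>_nonneg multiples_le by (rule sum_infsum_dual_le)
  qed (use w m summable_\<rho> summable_prod_\<rho> in \<open>auto simp: finite_nonzero_polys \<rho>_nonneg prod_nonneg\<close>)
  finally show ?thesis using w unfolding infsum_prod_\<rho>[OF w(1)] by simp
qed

text \<open>A nonzero polynomial of degree below \<open>m\<close> is invertible modulo
  \<open>p\<close>, so multiplying by it does not affect divisibility by \<open>p\<close>. This lets
  the prescribed first component 1 count as a minimizer.\<close>

lemma dual_sum_unit_vector_eq:
  assumes "q n \<in> nonzero_polys m" "q' n \<in> nonzero_polys m"
  shows "dual_sum b \<alpha> d p q {n} = dual_sum b \<alpha> d p q' {n}"
proof -
  have prime: "prime_elem p" using p(1) by (rule field_poly_irreducible_imp_prime)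
  have "p dvd t * z \<longleftrightarrow> p dvd t" if "z \<in> nonzero_polys m" for t z
  proof -
    have "\<not> p dvd z" using that p(2) dvd_degree_less_imp_eq_0[of p z] by (auto simp: nonzero_polys_def)
    then show ?thesis using prime by (simp add: prime_elem_dvd_mult_iff)
  qed
  then show ?thesis using assms by (simp add: dual_sum_def)
qed

section \<open>Averaging over the candidates and induction on the number of components\<close>

text \<open>The left side is the sum of the constant \<open>y powr lam\<close> over all candidates.
  After comparison with \<Theta>, subadditivity separates the sets \<open>w\<close>, and exchanging
  the two finite sums leaves one application of \<open>sum_dual_sum_le\<close> per
  \<open>w\<close>.\<close>

lemma minimizer_bound:
  fixes V :: "nat set \<Rightarrow> real"
  assumes V: "\<And>w. w \<in> W \<Longrightarrow> V w \<ge> 0" and W: "finite W" "\<And>w. w \<in> W \<Longrightarrow> finite w \<and> n \<notin> w"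
    and \<Theta>_def: "\<Theta> = (\<lambda>z. \<Sum>w\<in>W. V w * dual_sum b \<alpha> d p (q(n := z)) (insert n w))"
    and min: "\<And>z. z \<in> nonzero_polys m \<Longrightarrow> y \<le> \<Theta> z" and y: "y \<ge> 0"
  shows "(real b ^ m - 1) * y powr lam \<le> (\<Sum>w\<in>W. V w powr lam * S ^ card (insert n w))"
proof -
  define R where "R = (nonzero_polys m :: 'k poly set)"
  have "b ^ m \<ge> 1" using b2 by simp
  then have "(real b ^ m - 1) * y powr lam = (\<Sum>z\<in>R. y powr lam)"
    using card_nonzero_polys[OF m, where 'k = 'k] by (simp add: R_def b(2) of_nat_diff)
  also have "\<dots> \<le> (\<Sum>z\<in>R. \<Theta> z powr lam)"
    using min y lam_pos by (intro sum_mono powr_mono2) (auto simp: R_def)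
  also have "\<dots> \<le> (\<Sum>z\<in>R. \<Sum>w\<in>W. V w powr lam * dual_sum b \<alpha> d p (q(n := z)) (insert n w) powr lam)"
  proof (rule sum_mono)
    fix z
    have "\<Theta> z powr lam \<le> (\<Sum>w\<in>W. (V w * dual_sum b \<alpha> d p (q(n := z)) (insert n w)) powr lam)"
      unfolding \<Theta>_def using lam_pos lam(2) V by (intro powr_sum_le) (auto simp: dual_sum_nonneg)
    then show "\<Theta> z powr lam \<le> (\<Sum>w\<in>W. V w powr lam * dual_sum b \<alpha> d p (q(n := z)) (insert n w) powr lam)"
      using V by (simp add: powr_mult dual_sum_nonneg cong: sum.cong)
  qed
  also have "\<dots> = (\<Sum>w\<in>W. V w powr lam * (\<Sum>z\<in>R. dual_sum b \<alpha> d p (q(n := z)) (insert n w) powr lam))"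
    by (subst sum.swap) (simp add: sum_distrib_left)
  also have "\<dots> \<le> (\<Sum>w\<in>W. V w powr lam * S ^ card (insert n w))"
    unfolding R_def using W by (intro sum_mono mult_left_mono sum_dual_sum_le) auto
  finally show ?thesis .
qed

lemma B_crit_nonneg:
  assumes "\<And>u. u \<subseteq> {1..s} \<Longrightarrow> \<gamma> u \<ge> 0"
  shows "B_crit b s \<alpha> d \<gamma> r q p \<ge> 0"
  unfolding B_crit_eq using D_tilde_nonneg[OF b2 \<alpha>, of d]
  by (intro sum_nonneg mult_nonneg_nonneg dual_sum_nonneg assms) (auto simp: \<phi>_def)

text \<open>The induction starts at \<open>r = 0\<close>, where the criterion is an empty sum. Each
  step adds the terms of the sets containing the new index, to which \<open>minimizer_bound\<close>
  applies.\<close>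

lemma B_crit_powr_le:
  fixes \<gamma> :: "nat set \<Rightarrow> real" and q :: "nat \<Rightarrow> 'k poly"
  assumes \<gamma>: "\<And>u. u \<subseteq> {1..s} \<Longrightarrow> \<gamma> u \<ge> 0" and cbc: "cbc_output b m s \<alpha> d \<gamma> p q" and "r \<le> d * s"
  shows "(real b ^ m - 1) * B_crit b s \<alpha> d \<gamma> r q p powr lam \<le>
    (\<Sum>w\<in>Pow {1..r} - {{}}. (\<gamma> (\<phi> s d w) * D_tilde \<alpha> b d ^ card (\<phi> s d w)) powr lam * S ^ card w)"
  using assms(3)
proof (induction r)
  case 0
  then show ?case by (simp add: B_crit_eq)
next
  case (Suc r)
  define V where "V = (\<lambda>w. \<gamma> (\<phi> s d w) * D_tilde \<alpha> b d ^ card (\<phi> s d w))"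
  have V: "V w \<ge> 0" for w
    unfolding V_def using D_tilde_nonneg[OF b2 \<alpha>, of d]
    by (intro mult_nonneg_nonneg \<gamma> zero_le_power) (auto simp: \<phi>_def)
  define n where "n = Suc r"
  define \<Theta> where "\<Theta> = (\<lambda>z. \<Sum>w\<in>Pow {1..r}. V (insert n w) * dual_sum b \<alpha> d p (q(n := z)) (insert n w))"
  have split: "(\<Sum>w\<in>Pow {1..n} - {{}}. f w) = (\<Sum>w\<in>Pow {1..r} - {{}}. f w) + (\<Sum>w\<in>Pow {1..r}. f (insert n w))"
    for f :: "nat set \<Rightarrow> real"
    using sum_Pow_insert[of n "{1..r}" f]
    by (simp add: n_def atLeastAtMostSuc_conv sum_diff1 sum.distrib)
  \<comment> \<open>Sets without \<open>n\<close> do not see the value at \<open>n\<close>, so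
    minimizing the criterion over the new component amounts to minimizing \<Theta>.\<close>
  have B_split: "B_crit b s \<alpha> d \<gamma> n (q(n := z)) p = B_crit b s \<alpha> d \<gamma> r q p + \<Theta> z" for z
  proof -
    have "dual_sum b \<alpha> d p (q(n := z)) w = dual_sum b \<alpha> d p q w" if "w \<subseteq> {1..r}" for w
      using that by (intro dual_sum_cong) (auto simp: n_def)
    then show ?thesis
      unfolding B_crit_eq split \<Theta>_def
      by (intro arg_cong2[of _ _ _ _ "(+)"] sum.cong) (auto simp: V_def)
  qed
  have min: "\<Theta> (q n) \<le> \<Theta> z" if z: "z \<in> nonzero_polys m" for z
  proof (cases "r = 0")
    case True
    \<comment> \<open>For one component the criterion takes the same value at all candidates.\<close>
    have "q n \<in> nonzero_polys m"
      using cbc m True by (auto simp: cbc_output_def nonzero_polys_def n_def)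
    then show ?thesis
      using dual_sum_unit_vector_eq[of "q(n := z)" n q] z True by (simp add: \<Theta>_def)
  next
    case False
    then have "is_arg_min (\<lambda>z. B_crit b s \<alpha> d \<gamma> n (q(n := z)) p) (\<lambda>z. z \<in> nonzero_polys m) (q n)"
      using cbc Suc.prems unfolding cbc_output_def n_def by auto
    then show ?thesis using z unfolding is_arg_min_linorder B_split by auto
  qed
  have \<Theta>_nonneg: "\<Theta> (q n) \<ge> 0"
    unfolding \<Theta>_def by (intro sum_nonneg mult_nonneg_nonneg V dual_sum_nonneg)
  have B_nonneg: "B_crit b s \<alpha> d \<gamma> r q p \<ge> 0"
    using \<gamma> by (rule B_crit_nonneg)
  have bm: "real b ^ m - 1 \<ge> 0" using b2 by simp
  have "(real b ^ m - 1) * B_crit b s \<alpha> d \<gamma> n q p powr lam =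
      (real b ^ m - 1) * (B_crit b s \<alpha> d \<gamma> r q p + \<Theta> (q n)) powr lam"
    using B_split[of "q n"] by simp
  also have "\<dots> \<le> (real b ^ m - 1) * (B_crit b s \<alpha> d \<gamma> r q p powr lam + \<Theta> (q n) powr lam)"
    by (intro mult_left_mono powr_subadditive bm B_nonneg \<Theta>_nonneg lam_pos lam)
  also have "\<dots> = (real b ^ m - 1) * B_crit b s \<alpha> d \<gamma> r q p powr lam + (real b ^ m - 1) * \<Theta> (q n) powr lam"
    by (simp add: algebra_simps)
  also have "\<dots> \<le> (\<Sum>w\<in>Pow {1..r} - {{}}. V w powr lam * S ^ card w) +
      (\<Sum>w\<in>Pow {1..r}. V (insert n w) powr lam * S ^ card (insert n w))"
  proof (rule add_mono)
    show "(real b ^ m - 1) * B_crit b s \<alpha> d \<gamma> r q p powr lam \<le>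
        (\<Sum>w\<in>Pow {1..r} - {{}}. V w powr lam * S ^ card w)"
      using Suc by (simp add: V_def)
    show "(real b ^ m - 1) * \<Theta> (q n) powr lam \<le>
        (\<Sum>w\<in>Pow {1..r}. V (insert n w) powr lam * S ^ card (insert n w))"
      by (rule minimizer_bound[OF _ _ _ \<Theta>_def])
         (use V min \<Theta>_nonneg in \<open>auto simp: n_def intro: finite_subset\<close>)
  qed
  also have "\<dots> = (\<Sum>w\<in>Pow {1..n} - {{}}. V w powr lam * S ^ card w)"
    by (rule split[symmetric])
  finally show ?case by (simp only: n_def V_def)
qed

section \<open>From sums over index sets to the constants of the bound\<close>

text \<open>Each block met by \<open>w\<close> brings one factor \<open>E\<close> from the power of
  \<open>D_tilde\<close> and one factor \<open>(1 + S) ^ i - 1\<close> from the block sums, with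
  \<open>i = d\<close> for full blocks and \<open>i = a\<close> for the last. Together they are
  \<open>G i\<close>, and replacing \<open>S\<close> by the larger \<open>C_lambda\<close> gives
  \<open>G_const\<close>.\<close>

lemma sum_le_G_const:
  fixes \<gamma> :: "nat set \<Rightarrow> real"
  assumes "\<And>u. u \<subseteq> {1..s} \<Longrightarrow> \<gamma> u \<ge> 0" and a: "a \<le> d" "J < s"
  shows "(\<Sum>w\<in>Pow {1..d * J + a} - {{}}.
      (\<gamma> (\<phi> s d w) * D_tilde \<alpha> b d ^ card (\<phi> s d w)) powr lam * S ^ card w) \<le>
    (\<Sum>u\<in>Pow {1..J} - {{}}. \<gamma> u powr lam * G_const b \<alpha> d lam d ^ card u) +
    G_const b \<alpha> d lam a *
      (\<Sum>u\<in>Pow {1..J}. \<gamma> (u \<union> {Suc J}) powr lam * G_const b \<alpha> d lam d ^ card u)"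
proof -
  define E where "E = D_tilde \<alpha> b d powr lam"
  define G where "G = (\<lambda>i. E * ((1 + S) ^ i - 1))"
  \<comment> \<open>The value 0 at the empty set allows the sum to run over all \<open>w\<close>:
    only the empty \<open>w\<close> meets no block.\<close>
  define g where "g = (\<lambda>u. if u = {} then 0 else \<gamma> u powr lam * E ^ card u)"
  have D: "D_tilde \<alpha> b d \<ge> 0" using D_tilde_nonneg[OF b2 \<alpha>] .
  have D_pow: "(D_tilde \<alpha> b d ^ k) powr lam = E ^ k" for k
    by (induction k) (use D in \<open>auto simp: E_def powr_mult\<close>)
  have G_nonneg: "0 \<le> G i" for i
    unfolding G_def E_def using S_nonneg by auto
  have G_le: "G i \<le> G_const b \<alpha> d lam i" for i
  proof -
    have "(1 + S) ^ i \<le> (1 + C_lambda b \<alpha> d lam) ^ i"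
      using S_le_C_lambda S_nonneg by (intro power_mono) auto
    then show ?thesis
      unfolding G_def E_def G_const_def by (intro mult_left_mono) auto
  qed
  have "d * J + a \<le> d * Suc J" using a(1) by simp
  also have "\<dots> \<le> d * s" using a(2) by (intro mult_le_mono2) auto
  finally have r: "d * J + a \<le> d * s" .
  have "(\<Sum>w\<in>Pow {1..d * J + a} - {{}}.
      (\<gamma> (\<phi> s d w) * D_tilde \<alpha> b d ^ card (\<phi> s d w)) powr lam * S ^ card w) =
    (\<Sum>w\<in>Pow {1..d * J + a}. g (\<phi> s d w) * S ^ card w)"
  proof (rule sum.mono_neutral_cong_left)
    fix w assume w: "w \<in> Pow {1..d * J + a} - {{}}"
    then have "\<phi> s d w \<noteq> {}" using \<phi>_eq_empty_iff[OF d, of w s] r by fastforce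
    moreover have "\<phi> s d w \<subseteq> {1..s}" by (auto simp: \<phi>_def)
    ultimately show "(\<gamma> (\<phi> s d w) * D_tilde \<alpha> b d ^ card (\<phi> s d w)) powr lam * S ^ card w =
        g (\<phi> s d w) * S ^ card w"
      using assms(1) D by (simp add: g_def powr_mult D_pow)
  qed (auto simp: g_def \<phi>_def)
  also have "\<dots> = (\<Sum>u\<in>Pow {1..J}. (g u + ((1 + S) ^ a - 1) * g (insert (Suc J) u)) * ((1 + S) ^ d - 1) ^ card u)"
    by (rule sum_Pow_blocks[OF a])
  also have "\<dots> = (\<Sum>u\<in>Pow {1..J}. (if u = {} then 0 else \<gamma> u powr lam * G d ^ card u) +
      G a * (\<gamma> (u \<union> {Suc J}) powr lam * G d ^ card u))"
  proof (rule sum.cong)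
    fix u assume "u \<in> Pow {1..J}"
    then have "card (insert (Suc J) u) = Suc (card u)"
      by (subst card_insert_disjoint) (auto intro: finite_subset)
    moreover define K L where "K = (1 + S) ^ d - 1" and "L = (1 + S) ^ a - 1"
    moreover have "G d = E * K" "G a = E * L" by (simp_all add: G_def K_def L_def)
    ultimately show "(g u + ((1 + S) ^ a - 1) * g (insert (Suc J) u)) * ((1 + S) ^ d - 1) ^ card u =
      (if u = {} then 0 else \<gamma> u powr lam * G d ^ card u) +
      G a * (\<gamma> (u \<union> {Suc J}) powr lam * G d ^ card u)"
      unfolding K_def[symmetric] L_def[symmetric]
      by (simp add: g_def power_mult_distrib algebra_simps)
  qed simp
  also have "\<dots> = (\<Sum>u\<in>Pow {1..J} - {{}}. \<gamma> u powr lam * G d ^ card u) +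
      G a * (\<Sum>u\<in>Pow {1..J}. \<gamma> (u \<union> {Suc J}) powr lam * G d ^ card u)"
    unfolding sum.distrib sum_distrib_left[symmetric]
    by (intro arg_cong2[of _ _ _ _ "(+)"] sum.mono_neutral_cong_right) auto
  also have "\<dots> \<le> (\<Sum>u\<in>Pow {1..J} - {{}}. \<gamma> u powr lam * G_const b \<alpha> d lam d ^ card u) +
    G_const b \<alpha> d lam a *
      (\<Sum>u\<in>Pow {1..J}. \<gamma> (u \<union> {Suc J}) powr lam * G_const b \<alpha> d lam d ^ card u)"
    using order_trans[OF G_nonneg G_le]
    by (intro add_mono sum_mono mult_mono power_mono G_le G_nonneg order_refl)
       (auto intro!: sum_nonneg mult_nonneg_nonneg simp: G_nonneg)
  finally show ?thesis .
qed

end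

theorem theorem2:
  fixes b m s \<alpha> d r j1 d1 :: nat
    and \<gamma> :: "nat set \<Rightarrow> real"
    and p :: "'k::{field, finite} poly"
    and q :: "nat \<Rightarrow> 'k poly"
    and lam :: real
  assumes "prime b" and "CARD('k) = b"
    and "m \<ge> 1" and "s \<ge> 1" and "\<alpha> \<ge> 2" and "d \<ge> 1"
    and "\<And>u. u \<subseteq> {1..s} \<Longrightarrow> \<gamma> u \<ge> 0"
    and "cbc_output b m s \<alpha> d \<gamma> p q"
    and "1 \<le> r" and "r \<le> d * s"
    and "r = d * (j1 - 1) + d1" and "j1 \<ge> 1" and "d1 \<in> {1..d}"
    and "1 / (2 * real (min \<alpha> d)) < lam" and "lam \<le> 1"
  shows "B_crit b s \<alpha> d \<gamma> r q p \<le>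
    1 / (real b ^ m - 1) powr (1 / lam) *
    ((\<Sum>u\<in>Pow {1..j1 - 1} - {{}}. \<gamma> u powr lam * G_const b \<alpha> d lam d ^ card u) +
     G_const b \<alpha> d lam d1 *
       (\<Sum>u\<in>Pow {1..j1 - 1}. \<gamma> (u \<union> {j1}) powr lam * G_const b \<alpha> d lam d ^ card u)) powr (1 / lam)"
proof -
  interpret cbc_setting b m \<alpha> d lam p
    using assms by unfold_locales (auto simp: cbc_output_def)
  define J where "J = j1 - 1"
  have j1: "j1 = Suc J" and r: "r = d * J + d1" using assms by (auto simp: J_def)
  \<comment> \<open>Since \<open>d1\<close> is at least 1, \<open>d * J\<close> is strictly below
    \<open>r\<close>, so the block \<open>Suc J\<close> is one of the \<open>s\<close>
    blocks.\<close>
  have "d * J < d * s" using assms(10,13) unfolding r atLeastAtMost_iff by linarith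
  then have J: "J < s" by (rule mult_less_cancel1[THEN iffD1, THEN conjunct2])
  let ?B = "B_crit b s \<alpha> d \<gamma> r q p"
  let ?X = "(\<Sum>u\<in>Pow {1..J} - {{}}. \<gamma> u powr lam * G_const b \<alpha> d lam d ^ card u) +
     G_const b \<alpha> d lam d1 *
       (\<Sum>u\<in>Pow {1..J}. \<gamma> (u \<union> {Suc J}) powr lam * G_const b \<alpha> d lam d ^ card u)"
  have "1 < real b ^ m" using b2 m by (intro one_less_power) auto
  then have bm: "real b ^ m - 1 > 0" by simp
  have B_nonneg: "?B \<ge> 0"
    using assms(7) by (rule B_crit_nonneg)
  have "(real b ^ m - 1) * ?B powr lam \<le>
    (\<Sum>w\<in>Pow {1..r} - {{}}. (\<gamma> (\<phi> s d w) * D_tilde \<alpha> b d ^ card (\<phi> s d w)) powr lam * S ^ card w)"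
    using assms by (intro B_crit_powr_le) auto
  also have "\<dots> \<le> ?X"
    unfolding r using assms J by (intro sum_le_G_const) auto
  finally have bound: "(real b ^ m - 1) * ?B powr lam \<le> ?X" .
  then have "?B powr lam \<le> ?X / (real b ^ m - 1)"
    using bm by (simp add: field_simps)
  then have "(?B powr lam) powr (1 / lam) \<le> (?X / (real b ^ m - 1)) powr (1 / lam)"
    using lam_pos by (intro powr_mono2) auto
  \<comment> \<open>The sign is read off from the non-negative left side of \<open>bound\<close>; it
    lets the power \<open>1 / lam\<close> distribute over the quotient.\<close>
  moreover have "?X \<ge> 0"
    by (rule order_trans[OF _ bound]) (use bm in simp)
  ultimately have "?B \<le> 1 / (real b ^ m - 1) powr (1 / lam) * ?X powr (1 / lam)"
    using B_nonneg lam_pos bm by (simp add: powr_powr powr_divide)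
  then show ?thesis by (simp only: j1 J_def[symmetric] diff_Suc_1)
qed

end
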